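(* For every (constant) integer $k\ge 2$, there is a polynomial time algorithm that decides whether a complete instance of $k$-CSP (over the Boolean alphabet) is satisfiable or not.
   Context: A complete (Boolean) $k$-CSP instance is a pair $\mathcal{I}=(V,\mathcal{P})$ where $V$ is a finite set of variables taking values in $\{0,1\}$ and $\mathcal{P}$ contains exactly one constraint $P_S:\{0,1\}^S\to\{0,1\}$ for every $S\in\binom{V}{k}$ (value $1$ means satisfied, $0$ means unsatisfied), where each $P_S$ is nontrivial: it is unsatisfied for at least one assignment in $\{0,1\}^S$. The instance is satisfiable if there is $\alpha\in\{0,1\}^V$ such that $P_S(\alpha_S)=1$ for all $S\in\binom{V}{k}$, where $\alpha_S$ is the restriction of $\alpha$ to $S$. Polynomial time means polynomial in $n=|V|$ for each fixed $k$. *)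

theory Defs
  imports "HOL-Library.FuncSet" "HOL-Computational_Algebra.Polynomial"
begin

section \<open>Complete Boolean k-CSP instances\<close>

text \<open>
  An instance consists of a variable set \<open>V\<close> and a family \<open>P\<close> of constraints.  The set
  \<open>{0,1}\<^sup>S\<close> is rendered as \<open>S \<rightarrow>\<^sub>E UNIV\<close>, so the constraint on the scope \<open>S\<close> is \<open>P S\<close> seen as
  a function on \<open>S \<rightarrow>\<^sub>E UNIV\<close>; the values of \<open>P\<close> elsewhere are never consulted.
\<close>

type_synonym assignment = "nat \<Rightarrow> bool"
type_synonym constraints = "nat set \<Rightarrow> assignment \<Rightarrow> bool"

definition scopes :: "nat \<Rightarrow> nat set \<Rightarrow> nat set set" where
  "scopes k V = {S. S \<subseteq> V \<and> card S = k}"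

definition complete_csp :: "nat \<Rightarrow> nat set \<Rightarrow> constraints \<Rightarrow> bool" where
  "complete_csp k V P \<longleftrightarrow>
     finite V \<and> (\<forall>S\<in>scopes k V. \<exists>a \<in> S \<rightarrow>\<^sub>E (UNIV :: bool set). \<not> P S a)"

definition csp_satisfiable :: "nat \<Rightarrow> nat set \<Rightarrow> constraints \<Rightarrow> bool" where
  "csp_satisfiable k V P \<longleftrightarrow>
     (\<exists>\<alpha> \<in> V \<rightarrow>\<^sub>E (UNIV :: bool set). \<forall>S\<in>scopes k V. P S (restrict \<alpha> S))"


section \<open>Encoding of instances as bit strings\<close>

text \<open>
  The string starts with \<open>1\<^sup>n 0\<close> for \<open>n = card V\<close>.  Then, for every \<open>k\<close>-element scope \<open>S\<close>, there
  follows the incidence vector of \<open>S\<close> (one bit per variable, in increasing order of the variables)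
  and the full truth table of \<open>P S\<close> (\<open>2\<^sup>k\<close> bits, the value of the smallest variable of
  \<open>S\<close> changing fastest).  The length is
  \<open>n + 1 + (n choose k) * (n + 2\<^sup>k)\<close>, which is polynomial in \<open>n\<close> for fixed \<open>k\<close>.  The names of the
  variables do not occur in the string, only their positions in \<open>V\<close>.
\<close>

definition list_assignment :: "nat list \<Rightarrow> bool list \<Rightarrow> assignment" where
  "list_assignment xs bs = (\<lambda>v\<in>set xs. the (map_of (zip xs bs) v))"

definition truth_table :: "constraints \<Rightarrow> nat list \<Rightarrow> bool list" where
  "truth_table P xs =
     map (\<lambda>bs. P (set xs) (list_assignment xs bs)) (List.n_lists (length xs) [False, True])"

definition encode_constraint :: "nat list \<Rightarrow> constraints \<Rightarrow> nat list \<Rightarrow> bool list" where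
  "encode_constraint vs P xs = map (\<lambda>v. v \<in> set xs) vs @ truth_table P xs"

definition encode_csp :: "nat \<Rightarrow> nat set \<Rightarrow> constraints \<Rightarrow> bool list" where
  "encode_csp k V P =
     (let vs = sorted_list_of_set V
      in replicate (card V) True @ [False] @
         concat (map (encode_constraint vs P) (filter (\<lambda>xs. length xs = k) (subseqs vs))))"


section \<open>Deterministic multi-tape Turing machines\<close>

text \<open>
  States and tape symbols are natural numbers drawn from finite sets.  The symbol \<open>0\<close> is the
  blank, \<open>1\<close> and \<open>2\<close> represent the input bits \<open>0\<close> and \<open>1\<close>.  The transition function maps a state
  and the list of scanned symbols (one per tape) to a new state and, for each tape, a symbol to
  write and a head movement.  Only its values on the finitely many pairs of a non-halting state
  and a list of tape symbols matter.
\<close>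

datatype move = Left | Stay | Right

record turing_machine =
  num_tapes :: nat
  states :: "nat set"
  symbols :: "nat set"
  start :: nat
  accept :: nat
  reject :: nat
  trans :: "nat \<Rightarrow> nat list \<Rightarrow> nat \<times> (nat \<times> move) list"

definition wf_tm :: "turing_machine \<Rightarrow> bool" where
  "wf_tm M \<longleftrightarrow>
     num_tapes M \<ge> 1 \<and> finite (states M) \<and> finite (symbols M) \<and> {0, 1, 2} \<subseteq> symbols M \<and>
     {start M, accept M, reject M} \<subseteq> states M \<and> accept M \<noteq> reject M \<and>
     (\<forall>q \<in> states M - {accept M, reject M}. \<forall>rs. length rs = num_tapes M \<and> set rs \<subseteq> symbols M \<longrightarrow>
        (case trans M q rs of (q', acts) \<Rightarrow>
           q' \<in> states M \<and> length acts = num_tapes M \<and> fst ` set acts \<subseteq> symbols M))"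

text \<open>Tapes are infinite in both directions; a tape comes with the position of its head.\<close>

type_synonym tape = "(int \<Rightarrow> nat) \<times> int"
type_synonym tm_config = "nat \<times> tape list"

fun head_shift :: "move \<Rightarrow> int" where
  "head_shift Left = -1"
| "head_shift Stay = 0"
| "head_shift Right = 1"

fun act :: "nat \<times> move \<Rightarrow> tape \<Rightarrow> tape" where
  "act (s, d) (f, h) = (f(h := s), h + head_shift d)"

fun step :: "turing_machine \<Rightarrow> tm_config \<Rightarrow> tm_config" where
  "step M (q, ts) =
     (if q \<in> {accept M, reject M} then (q, ts)
      else case trans M q (map (\<lambda>(f, h). f h) ts) of (q', acts) \<Rightarrow> (q', map2 act acts ts))"

definition input_tape :: "bool list \<Rightarrow> tape" where
  "input_tape w =
     (\<lambda>i. if 0 \<le> i \<and> i < int (length w) then (if w ! nat i then 2 else 1) else 0, 0)"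

definition init_config :: "turing_machine \<Rightarrow> bool list \<Rightarrow> tm_config" where
  "init_config M w = (start M, input_tape w # replicate (num_tapes M - 1) (\<lambda>_. 0, 0))"

definition state_after :: "turing_machine \<Rightarrow> bool list \<Rightarrow> nat \<Rightarrow> nat" where
  "state_after M w t = fst ((step M ^^ t) (init_config M w))"

definition tm_accepts :: "turing_machine \<Rightarrow> bool list \<Rightarrow> bool" where
  "tm_accepts M w \<longleftrightarrow> (\<exists>t. state_after M w t = accept M)"

definition halts_within :: "turing_machine \<Rightarrow> bool list \<Rightarrow> nat \<Rightarrow> bool" where
  "halts_within M w T \<longleftrightarrow> (\<exists>t\<le>T. state_after M w t \<in> {accept M, reject M})"

end

theory Submission
  imports Defs "HOL-Library.Countable" "HOL-Library.Sublist"
begin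

text \<open>
  Order the variables and consider the partial assignments to initial segments that satisfy every
  constraint whose scope is assigned.  Since each scope excludes one local assignment, the good
  assignments to the first \<open>i\<close> variables shatter no \<open>k\<close>-element set, so by the Sauer-Shelah lemma
  there are only polynomially many of them.  Backtracking therefore visits polynomially many nodes.
  A two-tape machine runs this search: tape 2 holds the current partial assignment, and a node is
  tested by one pass over the list of constraints on tape 1.
\<close>

section \<open>The machine\<close>

text \<open>Pruning bounds the search only if good assignments are few at every depth. Completeness
  gives this: all \<open>k\<close>-subsets of an initial segment are themselves scopes, so the
  counting lemma applies to each level and not only to full solutions. A visited node is the root or
  a child of a good node, hence there are at most \<open>1 + 2 * g\<close> nodes for
  \<open>g\<close> good assignments above the last level. The machine may depend on \<open>k\<close>
  but not on \<open>n\<close>. The finite control therefore keeps at most \<open>k\<close> values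
  and a row index below \<open>2 ^ k\<close>, while lengths that grow with \<open>n\<close> are
  measured by tape 2: its \<open>n\<close> nonblank cells between blanks form a ruler that separates
  each incidence vector from the truth table behind it.\<close>

text \<open>
  \<open>Inc bs\<close> reads an incidence vector, with \<open>bs\<close> the values met so far; \<open>Tab i bs\<close> is at position \<open>i\<close>
  of the truth table that follows.  If some variable of the scope is unassigned, then \<open>bs\<close> is too
  short to match any row of the table, so the constraint is passed over.  \<open>Ext\<close> extends a good
  assignment by \<open>False\<close>; \<open>Incr\<close> backtracks to the last \<open>False\<close> and makes it \<open>True\<close>.  \<open>Rew\<close>, \<open>Hdr\<close>
  and \<open>Back\<close> return the heads to the first constraint and the first variable.
\<close>

datatype st = Init | Back | Inc "bool list" | Tab nat "bool list" | Ext | Incr | Rew | Hdr | Acc | Rej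

instance st :: countable
  by countable_datatype

text \<open>Tape 1 is read-only, so only its move is recorded. In \<open>Inc\<close> the end of the
  input is tested before the end of tape 2; this settles the case without variables and constraints,
  where both heads meet blanks. Entering \<open>Ext\<close> moves the input head back onto the word,
  since \<open>Rew\<close> stops at the first blank.\<close>

fun delta :: "nat \<Rightarrow> st \<Rightarrow> nat \<Rightarrow> nat \<Rightarrow> st \<times> move \<times> nat \<times> move" where
  "delta k Init x y = (if x = 2 then (Init, Right, 3, Right) else (Back, Right, y, Left))"
| "delta k Back x y = (if y = 0 then (Inc [], Stay, y, Right) else (Back, Stay, y, Left))"
| "delta k (Inc bs) x y =
     (if x = 0 then (Ext, Left, y, Stay)
      else if y = 0 then (Tab 0 bs, Stay, y, Stay)
      else if x = 2 \<and> y \<noteq> 3 then (Inc (take k (bs @ [y = 2])), Right, y, Right)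
      else (Inc bs, Right, y, Right))"
| "delta k (Tab i bs) x y =
     (if List.n_lists k [False, True] ! i = bs \<and> x = 1 then (Incr, Stay, y, Left)
      else if Suc i < 2 ^ k then (Tab (Suc i) bs, Right, y, Stay)
      else (Back, Right, y, Left))"
| "delta k Ext x y =
     (if y = 0 then (Acc, Stay, y, Stay)
      else if y = 3 then (Rew, Stay, 1, Stay)
      else (Ext, Stay, y, Right))"
| "delta k Incr x y =
     (if y = 0 then (Rej, Stay, y, Stay)
      else if y = 1 then (Rew, Stay, 2, Stay)
      else (Incr, Stay, 3, Left))"
| "delta k Rew x y = (if x = 0 then (Hdr, Right, y, Stay) else (Rew, Left, y, Stay))"
| "delta k Hdr x y = (if x = 2 then (Hdr, Right, y, Stay) else (Back, Right, y, Stay))"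
| "delta k Acc x y = (Acc, Stay, y, Stay)"
| "delta k Rej x y = (Rej, Stay, y, Stay)"

definition state_set :: "nat \<Rightarrow> st set" where
  "state_set k = {Init, Back, Ext, Incr, Rew, Hdr, Acc, Rej} \<union>
     Inc ` {bs. set bs \<subseteq> UNIV \<and> length bs \<le> k} \<union>
     (\<lambda>(i, bs). Tab i bs) ` ({..<2 ^ k} \<times> {bs. set bs \<subseteq> UNIV \<and> length bs \<le> k})"

definition search_tm :: "nat \<Rightarrow> turing_machine" where
  "search_tm k =
     \<lparr>num_tapes = 2, states = to_nat ` state_set k, symbols = {0, 1, 2, 3},
      start = to_nat Init, accept = to_nat Acc, reject = to_nat Rej,
      trans = (\<lambda>q rs. case delta k (from_nat q) (rs ! 0) (rs ! 1) of
                 (q', d, s, e) \<Rightarrow> (to_nat q', [(rs ! 0, d), (s, e)]))\<rparr>"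

text \<open>The truncation \<open>take k\<close> and the guard \<open>Suc i < 2 ^ k\<close> keep the
  control finite whatever tape 1 contains, including strings that encode no instance.\<close>

lemma delta_closed:
  assumes "delta k q x y = (q', d, s, e)" "q \<in> state_set k" "y \<in> {0, 1, 2, 3}"
  shows "q' \<in> state_set k" "s \<in> {0, 1, 2, 3}"
  using assms by (cases q; auto simp: state_set_def split: if_splits)+

lemma search_tm_simps:
  "num_tapes (search_tm k) = 2" "states (search_tm k) = to_nat ` state_set k"
  "symbols (search_tm k) = {0, 1, 2, 3}" "start (search_tm k) = to_nat Init"
  "accept (search_tm k) = to_nat Acc" "reject (search_tm k) = to_nat Rej"
  by (simp_all add: search_tm_def)

lemma trans_search_tm:
  assumes "delta k q (rs ! 0) (rs ! 1) = (q', d, s, e)"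
  shows "trans (search_tm k) (to_nat q) rs = (to_nat q', [(rs ! 0, d), (s, e)])"
  by (simp only: search_tm_def turing_machine.select_convs from_nat_to_nat assms prod.case)

lemma finite_state_set: "finite (state_set k)"
  unfolding state_set_def
  by (intro finite_UnI finite_imageI finite_cartesian_product finite_lists_length_le) auto

lemma wf_search_tm: "wf_tm (search_tm k)"
proof -
  have "case trans (search_tm k) (to_nat q) rs of (q', acts) \<Rightarrow>
      q' \<in> to_nat ` state_set k \<and> length acts = 2 \<and> fst ` set acts \<subseteq> {0, 1, 2, 3}"
    if "q \<in> state_set k" and rs: "length rs = 2" "set rs \<subseteq> {0, 1, 2, 3}" for q rs
  proof -
    obtain q' d s e where d: "delta k q (rs ! 0) (rs ! 1) = (q', d, s, e)"
      by (rule prod_cases4)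
    have "rs ! 0 \<in> set rs" "rs ! 1 \<in> set rs"
      using rs(1) by (simp_all del: One_nat_def)
    then have "rs ! 0 \<in> {0, 1, 2, 3}" "rs ! 1 \<in> {0, 1, 2, 3}"
      using rs(2) by blast+
    with delta_closed[OF d that(1)] show ?thesis
      by (simp add: trans_search_tm[OF d] del: insert_iff One_nat_def)
  qed
  then have "\<forall>q\<in>to_nat ` state_set k - {to_nat Acc, to_nat Rej}. \<forall>rs. length rs = 2 \<and> set rs \<subseteq> {0, 1, 2, 3} \<longrightarrow>
      (case trans (search_tm k) q rs of (q', acts) \<Rightarrow>
        q' \<in> to_nat ` state_set k \<and> length acts = 2 \<and> fst ` set acts \<subseteq> {0, 1, 2, 3})"
    by (intro ballI allI impI) (elim DiffE imageE, simp only:)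
  moreover have "{to_nat Init, to_nat Acc, to_nat Rej} \<subseteq> to_nat ` state_set k"
    by (auto simp: state_set_def)
  moreover have "finite (to_nat ` state_set k)"
    using finite_state_set by (rule finite_imageI)
  ultimately show ?thesis
    unfolding wf_tm_def search_tm_simps by (intro conjI; (assumption | simp))
qed

section \<open>Timed runs\<close>

text \<open>\<open>T\<close> only bounds the number of steps, so that runs compose with rounded
  estimates.\<close>

definition runs :: "nat \<Rightarrow> tm_config \<Rightarrow> nat \<Rightarrow> tm_config \<Rightarrow> bool" where
  "runs k c T c' \<longleftrightarrow> (\<exists>t\<le>T. (step (search_tm k) ^^ t) c = c')"

lemma runs_refl: "runs k c T c"
  unfolding runs_def by (rule exI[of _ 0]) simp

lemma runs_trans:
  assumes "runs k c T c'" "runs k c' T' c''" "T + T' \<le> U"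
  shows "runs k c U c''"
proof -
  obtain t t' where "t \<le> T" "(step (search_tm k) ^^ t) c = c'"
    "t' \<le> T'" "(step (search_tm k) ^^ t') c' = c''"
    using assms unfolding runs_def by blast
  then show ?thesis
    using assms(3) unfolding runs_def by (intro exI[of _ "t' + t"]) (simp add: funpow_add)
qed

lemma runs_mono: "runs k c T c' \<Longrightarrow> T \<le> U \<Longrightarrow> runs k c U c'"
  using runs_trans[OF _ runs_refl, of k c T c' 0] by simp

text \<open>A halting configuration is a fixed point of \<open>step\<close>. Hence acceptance at
  some time can be decided by looking at any one time at which the machine has halted.\<close>

lemma halting_fixed:
  assumes "state_after M w t \<in> {accept M, reject M}" "t \<le> u"
  shows "state_after M w u = state_after M w t"
proof -
  obtain d where d: "u = d + t"
    using assms(2) by (metis add.commute le_Suc_ex)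
  obtain q ts where q: "(step M ^^ t) (init_config M w) = (q, ts)"
    by fastforce
  have "(step M ^^ d) (q, ts) = (q, ts)"
    using assms(1) q by (induction d) (auto simp: state_after_def)
  then show ?thesis
    by (simp add: state_after_def d funpow_add q)
qed

lemma step_search_tm:
  assumes "delta k q (f h) (g j) = (q', d, s, e)" "q \<noteq> Acc" "q \<noteq> Rej"
  shows "step (search_tm k) (to_nat q, [(f, h), (g, j)]) =
    (to_nat q', [(f, h + head_shift d), (g(j := s), j + head_shift e)])"
  using assms by (simp add: search_tm_simps trans_search_tm)

lemma runs_step:
  assumes "delta k q (f h) (g j) = (q', d, s, e)" "q \<noteq> Acc" "q \<noteq> Rej"
    and "runs k (to_nat q', [(f, h + head_shift d), (g(j := s), j + head_shift e)]) T c"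
  shows "runs k (to_nat q, [(f, h), (g, j)]) (Suc T) c"
proof (rule runs_trans[OF _ assms(4)])
  show "runs k (to_nat q, [(f, h), (g, j)]) 1
      (to_nat q', [(f, h + head_shift d), (g(j := s), j + head_shift e)])"
    unfolding runs_def using step_search_tm[of k q f h g j, OF assms(1-3)] by (intro exI[of _ 1]) simp
qed simp

section \<open>Tape contents and violated constraints\<close>

definition code :: "bool \<Rightarrow> nat" where
  "code b = (if b then 2 else 1)"

text \<open>Tape 2 while the partial assignment \<open>a\<close> is being examined; the symbol 3 marks a variable
  without a value.\<close>

definition tap :: "nat \<Rightarrow> bool list \<Rightarrow> int \<Rightarrow> nat" where
  "tap n a i = (if 0 \<le> i \<and> i < int n then if i < int (length a) then code (a ! nat i) else 3 else 0)"

lemma tap_append: "length a < n \<Longrightarrow> (tap n a)(int (length a) := code b) = tap n (a @ [b])"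
  by (auto simp: fun_eq_iff tap_def nth_append)

lemma tap_replace: "length a < n \<Longrightarrow> (tap n (a @ [b]))(int (length a) := code c) = tap n (a @ [c])"
  by (auto simp: fun_eq_iff tap_def nth_append)

lemma tap_remove: "length a < n \<Longrightarrow> (tap n (a @ [b]))(int (length a) := 3) = tap n a"
  by (auto simp: fun_eq_iff tap_def nth_append)

text \<open>\<open>zip\<close> cuts the incidence vector off at the length of \<open>a\<close>, so
  unassigned variables of the scope contribute no value.\<close>

definition selected :: "bool list \<Rightarrow> bool list \<Rightarrow> bool list" where
  "selected fs a = map snd (filter fst (zip fs a))"

lemma selected_simps [simp]:
  "selected [] a = []" "selected fs [] = []"
  "selected (f # fs) (b # a) = (if f then b # selected fs a else selected fs a)"
  by (simp_all add: selected_def)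

lemma selected_append: "\<exists>bs. selected fs (a @ c) = selected fs a @ bs"
proof (induction fs arbitrary: a)
  case (Cons f fs)
  then show ?case by (cases a) auto
qed simp

lemma selected_take_Suc:
  assumes "j < length fs"
  shows "selected (take (Suc j) fs) a =
    selected (take j fs) a @ (if fs ! j \<and> j < length a then [a ! j] else [])"
  using assms
proof (induction fs arbitrary: j a)
  case (Cons f fs)
  then show ?case by (cases a; cases j) auto
qed simp

text \<open>The \<open>take k\<close> mirrors the truncation in state \<open>Inc\<close>. On the
  blocks of an instance the incidence vector marks exactly \<open>k\<close> variables, and there it
  changes nothing.\<close>

definition violated :: "nat \<Rightarrow> bool list \<Rightarrow> bool list \<times> bool list \<Rightarrow> bool" where
  "violated k a = (\<lambda>(fs, tt). \<exists>i<2 ^ k. List.n_lists k [False, True] ! i = take k (selected fs a) \<and> \<not> tt ! i)"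

lemma length_nth_n_lists: "i < 2 ^ k \<Longrightarrow> length (List.n_lists k [False, True] ! i) = k"
  using length_n_lists_elem[OF nth_mem, of i k "[False, True]"]
  by (simp add: length_n_lists numeral_2_eq_2)

text \<open>This justifies pruning. A matching row has length \<open>k\<close>, so all
  \<open>k\<close> values had been read already, and later values come behind them.\<close>

lemma violated_append: "violated k a b \<Longrightarrow> violated k (a @ c) b"
proof -
  assume v: "violated k a b"
  obtain fs tt where b: "b = (fs, tt)" by fastforce
  obtain i where i: "i < 2 ^ k" "List.n_lists k [False, True] ! i = take k (selected fs a)" "\<not> tt ! i"
    using v by (auto simp: violated_def b)
  have "length (take k (selected fs a)) = k"
    using length_nth_n_lists[OF i(1)] i(2) by simp
  then have "take k (selected fs (a @ c)) = take k (selected fs a)"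
    using selected_append[of fs a c] by auto
  with i show ?thesis
    by (auto simp: violated_def b)
qed

section \<open>Runs on words made of blocks of the right lengths\<close>

locale encoded =
  fixes k n :: nat and blocks :: "(bool list \<times> bool list) list"
  assumes block_length: "\<And>fs tt. (fs, tt) \<in> set blocks \<Longrightarrow> length fs = n \<and> length tt = 2 ^ k"
begin

definition word :: "bool list" where
  "word = replicate n True @ False # concat (map (\<lambda>(fs, tt). fs @ tt) blocks)"

definition inp :: "int \<Rightarrow> nat" where
  "inp = fst (input_tape word)"

abbreviation conf :: "st \<Rightarrow> int \<Rightarrow> (int \<Rightarrow> nat) \<Rightarrow> int \<Rightarrow> tm_config" where
  "conf q h g j \<equiv> (to_nat q, [(inp, h), (g, j)])"

lemma runs_conf:
  assumes "delta k q (inp h) (g j) = (q', d, s, e)" "q \<noteq> Acc" "q \<noteq> Rej"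
    and "runs k (conf q' (h + head_shift d) (g(j := s)) (j + head_shift e)) T c"
  shows "runs k (conf q h g j) (Suc T) c"
  by (rule runs_step[of k q inp h g j, OF assms])

lemma inp_nth: "i < length word \<Longrightarrow> inp (int i) = code (word ! i)"
  by (simp add: inp_def input_tape_def code_def)

lemma inp_outside: "i < 0 \<or> int (length word) \<le> i \<Longrightarrow> inp i = 0"
  by (auto simp: inp_def input_tape_def)

lemma length_word_gt: "n < length word"
  by (simp add: word_def)

lemma inp_header: "i < n \<Longrightarrow> inp (int i) = 2" "inp (int n) = 1"
  using inp_nth[of i] inp_nth[of n] length_word_gt
  by (auto simp: word_def nth_append code_def)

lemma length_word: "length word = n + 1 + length blocks * (n + 2 ^ k)"
proof -
  have "length (concat (map (\<lambda>(fs, tt). fs @ tt) bs)) = length bs * (n + 2 ^ k)"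
    if "set bs \<subseteq> set blocks" for bs
    using that by (induction bs) (auto dest: block_length)
  then show ?thesis by (simp add: word_def)
qed

text \<open>Each 1 of the unary header lays down one unassigned cell. After \<open>i\<close> symbols
  tape 2 is the tape for \<open>i\<close> variables, which gives the invariant
  \<open>tap i []\<close>.\<close>

lemma runs_init: "runs k (conf Init 0 (\<lambda>_. 0) 0) (Suc n) (conf Back (int n + 1) (tap n []) (int n - 1))"
proof -
  have "runs k (conf Init 0 (\<lambda>_. 0) 0) i (conf Init (int i) (tap i []) (int i))" if "i \<le> n" for i
    using that
  proof (induction i)
    case 0
    have "tap 0 [] = (\<lambda>_. 0)" by (auto simp: tap_def)
    then show ?case by (simp add: runs_refl)
  next
    case (Suc i)
    have "(tap i [])(int i := 3) = tap (Suc i) []"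
      by (auto simp: tap_def)
    then have "runs k (conf Init (int i) (tap i []) (int i)) 1
        (conf Init (int (Suc i)) (tap (Suc i) []) (int (Suc i)))"
      using Suc.prems runs_conf[of Init "int i" "tap i []" "int i" Init Right 3 Right 0]
      by (simp add: inp_header runs_refl add.commute)
    with Suc show ?case by (auto intro: runs_trans)
  qed
  from runs_trans[OF this[OF order_refl], of 1] show ?thesis
    using runs_conf[of Init "int n" "tap n []" "int n" Back Right 0 Left 0]
    by (simp add: inp_header runs_refl tap_def fun_upd_idem)
qed

text \<open>Starting from \<open>int m - 1\<close> includes the head that already rests on the left
  blank, as happens when there are no variables.\<close>

lemma runs_back:
  assumes "\<And>i. 0 \<le> i \<Longrightarrow> i < int m \<Longrightarrow> g i \<noteq> 0" "g (-1) = 0"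
  shows "runs k (conf Back h g (int m - 1)) (Suc m) (conf (Inc []) h g 0)"
  using assms
proof (induction m)
  case 0
  then show ?case
    by (intro runs_conf[where T = 0]) (auto simp: fun_upd_idem runs_refl)
next
  case (Suc m)
  then have "runs k (conf Back h g (int m - 1)) (Suc m) (conf (Inc []) h g 0)"
    by simp
  with Suc.prems(1)[of "int m"] show ?case
    by (intro runs_conf[where T = "Suc m"]) (auto simp: fun_upd_idem)
qed

section \<open>Testing the constraints\<close>

lemma runs_incidence:
  assumes "length fs = n" "\<And>j. j < n \<Longrightarrow> inp (h + int j) = code (fs ! j)" "j \<le> n"
  shows "runs k (conf (Inc []) h (tap n a) 0) j
    (conf (Inc (take k (selected (take j fs) a))) (h + int j) (tap n a) (int j))"
  using assms(3)
proof (induction j)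
  case 0
  then show ?case by (simp add: selected_def runs_refl)
next
  case (Suc j)
  let ?b = "selected (take j fs) a"
  have t: "tap n a (int j) = (if j < length a then code (a ! j) else 3)" "inp (h + int j) = code (fs ! j)"
    using Suc.prems assms by (auto simp: tap_def)
  have "runs k (conf (Inc (take k ?b)) (h + int j) (tap n a) (int j)) (Suc 0)
     (conf (Inc (take k (selected (take (Suc j) fs) a))) (h + int (Suc j)) (tap n a) (int (Suc j)))"
  proof (rule runs_conf[where q' = "Inc (take k (selected (take (Suc j) fs) a))" and d = Right
        and e = Right and s = "tap n a (int j)"])
    show "delta k (Inc (take k ?b)) (inp (h + int j)) (tap n a (int j)) =
      (Inc (take k (selected (take (Suc j) fs) a)), Right, tap n a (int j), Right)"
      using Suc.prems assms(1) selected_take_Suc[of j fs a] t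
      by (auto simp: code_def min_def split: if_splits)
  qed (simp_all add: fun_upd_idem runs_refl algebra_simps)
  with Suc show ?case by (auto intro: runs_trans)
qed

lemma runs_table:
  assumes "\<And>i. i < 2 ^ k \<Longrightarrow> inp (h + int i) = code (tt ! i)"
    and "\<And>i. i < j \<Longrightarrow> \<not> (List.n_lists k [False, True] ! i = bs \<and> \<not> tt ! i)" "j < 2 ^ k"
  shows "runs k (conf (Tab 0 bs) h g l) j (conf (Tab j bs) (h + int j) g l)"
  using assms(2,3)
proof (induction j)
  case 0
  then show ?case by (simp add: runs_refl)
next
  case (Suc j)
  have "runs k (conf (Tab j bs) (h + int j) g l) (Suc 0) (conf (Tab (Suc j) bs) (h + int (Suc j)) g l)"
    using Suc.prems assms(1)[of j]
    by (intro runs_conf[where T = 0 and q' = "Tab (Suc j) bs" and d = Right and s = "g l" and e = Stay])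
       (auto simp: fun_upd_idem runs_refl code_def algebra_simps)
  with Suc show ?case by (auto intro: runs_trans)
qed

lemma runs_table_ok:
  assumes "\<And>i. i < 2 ^ k \<Longrightarrow> inp (h + int i) = code (tt ! i)"
    and "\<And>i. i < 2 ^ k \<Longrightarrow> \<not> (List.n_lists k [False, True] ! i = bs \<and> \<not> tt ! i)"
  shows "runs k (conf (Tab 0 bs) h g l) (2 ^ k) (conf Back (h + 2 ^ k) g (l - 1))"
proof -
  \<comment> \<open>The last row is treated apart: from it the machine goes to \<open>Back\<close>
    and not to a further \<open>Tab\<close> state.\<close>
  define j where "j = (2::nat) ^ k - 1"
  have j: "j < 2 ^ k" "Suc j = 2 ^ k" by (simp_all add: j_def)
  then have jj: "h + int j + 1 = h + 2 ^ k"
    by (metis add.assoc int_ops(4) add.commute of_nat_numeral of_nat_power)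
  have "runs k (conf (Tab 0 bs) h g l) j (conf (Tab j bs) (h + int j) g l)"
    using assms j by (intro runs_table) auto
  moreover have "runs k (conf (Tab j bs) (h + int j) g l) (Suc 0) (conf Back (h + 2 ^ k) g (l - 1))"
    using assms(1)[of j] assms(2)[of j] j jj
    by (intro runs_conf[where T = 0 and q' = Back and d = Right and s = "g l" and e = Left])
       (auto simp: fun_upd_idem runs_refl code_def simp flip: jj)
  ultimately show ?thesis using j by (auto intro: runs_trans)
qed

lemma runs_table_violated:
  assumes "\<And>i. i < 2 ^ k \<Longrightarrow> inp (h + int i) = code (tt ! i)"
    and "\<exists>i<2 ^ k. List.n_lists k [False, True] ! i = bs \<and> \<not> tt ! i"
  shows "\<exists>i<2 ^ k. runs k (conf (Tab 0 bs) h g l) (2 ^ k) (conf Incr (h + int i) g (l - 1))"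
proof -
  \<comment> \<open>The scan leaves the table at the first violating row, so the least index is the
    one that is reached.\<close>
  define j where "j = (LEAST i. i < 2 ^ k \<and> List.n_lists k [False, True] ! i = bs \<and> \<not> tt ! i)"
  have j: "j < 2 ^ k" "List.n_lists k [False, True] ! j = bs" "\<not> tt ! j"
    using LeastI_ex[OF assms(2)] by (simp_all add: j_def)
  have "\<not> (List.n_lists k [False, True] ! i = bs \<and> \<not> tt ! i)" if "i < j" for i
    using not_less_Least[of i, folded j_def] that j(1) unfolding j_def by fastforce
  then have "runs k (conf (Tab 0 bs) h g l) j (conf (Tab j bs) (h + int j) g l)"
    using assms j by (intro runs_table) auto
  moreover have "runs k (conf (Tab j bs) (h + int j) g l) (Suc 0) (conf Incr (h + int j) g (l - 1))"
    using assms(1)[of j] j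
    by (intro runs_conf[where T = 0 and q' = Incr and d = Stay and s = "g l" and e = Left])
       (auto simp: fun_upd_idem runs_refl code_def)
  ultimately have "runs k (conf (Tab 0 bs) h g l) (2 ^ k) (conf Incr (h + int j) g (l - 1))"
    using j by (auto intro: runs_trans)
  with j show ?thesis by blast
qed


text \<open>The time is \<open>n\<close> for the incidence vector, 1 to enter the table, at most
  \<open>2 ^ k\<close> in it and \<open>n + 1\<close> for the way back on tape 2. A violation leaves
  the input head somewhere inside the block; rewinding later needs only that it is within the
  word.\<close>

lemma runs_block:
  assumes "length fs = n" "length tt = 2 ^ k"
    and "\<And>i. i < n + 2 ^ k \<Longrightarrow> inp (h + int i) = code ((fs @ tt) ! i)"
  shows "\<not> violated k a (fs, tt) \<Longrightarrow>
      runs k (conf (Inc []) h (tap n a) 0) (2 * n + 2 + 2 ^ k) (conf (Inc []) (h + n + 2 ^ k) (tap n a) 0)"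
    and "violated k a (fs, tt) \<Longrightarrow> \<exists>i<n + 2 ^ k.
      runs k (conf (Inc []) h (tap n a) 0) (2 * n + 2 + 2 ^ k) (conf Incr (h + int i) (tap n a) (int n - 1))"
proof -
  let ?bs = "take k (selected fs a)"
  have table: "inp (h + int n + int i) = code (tt ! i)" if "i < 2 ^ k" for i
    using assms(3)[of "n + i"] assms(1) that by (simp add: nth_append add.assoc)
  have "runs k (conf (Inc []) h (tap n a) 0) n (conf (Inc ?bs) (h + int n) (tap n a) (int n))"
    using runs_incidence[of fs h n a] assms(1) assms(3) by (simp add: nth_append)
  \<comment> \<open>The blank in cell \<open>n\<close> of tape 2 ends the incidence vector. The
    first table cell is nonblank by \<open>table[of 0]\<close>; a blank there would be taken for the
    end of the input.\<close>
  moreover have "runs k (conf (Inc ?bs) (h + int n) (tap n a) (int n)) (Suc 0)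
      (conf (Tab 0 ?bs) (h + int n) (tap n a) (int n))"
    using table[of 0]
    by (intro runs_conf[where T = 0 and q' = "Tab 0 ?bs" and d = Stay and s = 0 and e = Stay])
       (auto simp: fun_upd_idem runs_refl code_def tap_def)
  ultimately have start: "runs k (conf (Inc []) h (tap n a) 0) (Suc n)
      (conf (Tab 0 ?bs) (h + int n) (tap n a) (int n))"
    by (auto intro: runs_trans)
  show "runs k (conf (Inc []) h (tap n a) 0) (2 * n + 2 + 2 ^ k) (conf (Inc []) (h + n + 2 ^ k) (tap n a) 0)"
    if "\<not> violated k a (fs, tt)"
  proof -
    have "runs k (conf (Inc []) h (tap n a) 0) (Suc n + 2 ^ k)
        (conf Back (h + n + 2 ^ k) (tap n a) (int n - 1))"
      using that by (intro runs_trans[OF start runs_table_ok[OF table]]) (auto simp: violated_def)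
    moreover have "runs k (conf Back (h + n + 2 ^ k) (tap n a) (int n - 1)) (Suc n)
        (conf (Inc []) (h + n + 2 ^ k) (tap n a) 0)"
      by (rule runs_back) (auto simp: tap_def code_def)
    ultimately show ?thesis by (rule runs_trans) simp
  qed
  show "\<exists>i<n + 2 ^ k. runs k (conf (Inc []) h (tap n a) 0) (2 * n + 2 + 2 ^ k)
      (conf Incr (h + int i) (tap n a) (int n - 1))"
    if "violated k a (fs, tt)"
  proof -
    from that obtain i where i: "i < 2 ^ k" "runs k (conf (Tab 0 ?bs) (h + int n) (tap n a) (int n)) (2 ^ k)
        (conf Incr (h + int n + int i) (tap n a) (int n - 1))"
      using runs_table_violated[OF table, of ?bs "tap n a" "int n"] by (auto simp: violated_def)
    have "runs k (conf (Inc []) h (tap n a) 0) (2 * n + 2 + 2 ^ k)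
      (conf Incr (h + int (n + i)) (tap n a) (int n - 1))"
      by (rule runs_trans[OF start i(2)[unfolded add.assoc of_nat_add[symmetric]]]) simp
    with i(1) show ?thesis by (intro exI[of _ "n + i"]) simp
  qed
qed

text \<open>The additional step is the one that meets the blank behind the last block.\<close>

definition check_time :: nat where
  "check_time = length blocks * (2 * n + 2 + 2 ^ k) + 1"

definition good :: "bool list \<Rightarrow> bool" where
  "good a \<longleftrightarrow> (\<forall>b\<in>set blocks. \<not> violated k a b)"

lemma good_append: "good (a @ c) \<Longrightarrow> good a"
  unfolding good_def using violated_append by blast

text \<open>Induction over suffixes of the block list: \<open>h\<close> is where the suffix begins,
  and the length equation says that it reaches to the end of the word. The blank behind it then
  signals that every constraint has passed.\<close>

lemma runs_blocks:
  assumes "set bs \<subseteq> set blocks"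
    and "h + int (length (concat (map (\<lambda>(fs, tt). fs @ tt) bs))) = int (length word)"
    and "\<And>i. i < length (concat (map (\<lambda>(fs, tt). fs @ tt) bs)) \<Longrightarrow>
      inp (h + int i) = code (concat (map (\<lambda>(fs, tt). fs @ tt) bs) ! i)"
    and "0 \<le> h"
  shows "if \<forall>b\<in>set bs. \<not> violated k a b
    then runs k (conf (Inc []) h (tap n a) 0) (length bs * (2 * n + 2 + 2 ^ k) + 1)
      (conf Ext (int (length word) - 1) (tap n a) 0)
    else \<exists>h'\<ge>0. h' < int (length word) \<and>
      runs k (conf (Inc []) h (tap n a) 0) (length bs * (2 * n + 2 + 2 ^ k) + 1)
        (conf Incr h' (tap n a) (int n - 1))"
  using assms
proof (induction bs arbitrary: h)
  case Nil
  then have "inp h = 0" by (simp add: inp_outside)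
  then have "runs k (conf (Inc []) h (tap n a) 0) (Suc 0) (conf Ext (h - 1) (tap n a) 0)"
    by (intro runs_conf[where T = 0 and q' = Ext and d = Left and s = "tap n a 0" and e = Stay])
       (auto simp: runs_refl)
  with Nil show ?case by simp
next
  case (Cons b bs)
  obtain fs tt where b: "b = (fs, tt)" by fastforce
  have len: "length fs = n" "length tt = 2 ^ k"
    using Cons.prems(1) block_length b by auto
  let ?B = "2 * n + 2 + 2 ^ k" and ?h = "h + int n + 2 ^ k"
  let ?cat = "concat (map (\<lambda>(fs, tt). fs @ tt) bs)"
  have total: "?h + int (length ?cat) = int (length word)"
    using Cons.prems(2) len by (simp add: b algebra_simps)
  have fst_block: "inp (h + int i) = code ((fs @ tt) ! i)" if "i < n + 2 ^ k" for i
    using Cons.prems(3)[of i] that len by (simp add: b nth_append split: if_splits)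
  show ?case
  proof (cases "violated k a (fs, tt)")
    case True
    then obtain i where i: "i < n + 2 ^ k"
      "runs k (conf (Inc []) h (tap n a) 0) ?B (conf Incr (h + int i) (tap n a) (int n - 1))"
      using runs_block(2)[OF len fst_block] by blast
    have "int i < int n + 2 ^ k"
      using i(1) by (metis of_nat_add of_nat_less_iff of_nat_numeral of_nat_power)
    then have "h + int i < int (length word)"
      using total by linarith
    moreover have "runs k (conf (Inc []) h (tap n a) 0) (length (b # bs) * ?B + 1)
        (conf Incr (h + int i) (tap n a) (int n - 1))"
      by (rule runs_mono[OF i(2)]) simp
    moreover have "0 \<le> h + int i" using Cons.prems(4) by simp
    moreover have "\<not> (\<forall>b\<in>set (b # bs). \<not> violated k a b)"
      using True b by auto
    ultimately show ?thesis by (auto simp del: of_nat_add)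
  next
    case False
    have first: "runs k (conf (Inc []) h (tap n a) 0) ?B (conf (Inc []) ?h (tap n a) 0)"
      using runs_block(1)[OF len fst_block False] .
    have "inp (?h + int i) = code (?cat ! i)" if "i < length ?cat" for i
      using Cons.prems(3)[of "n + 2 ^ k + i"] that len by (simp add: b nth_append add.assoc)
    then have IH: "if \<forall>b\<in>set bs. \<not> violated k a b
      then runs k (conf (Inc []) ?h (tap n a) 0) (length bs * ?B + 1)
        (conf Ext (int (length word) - 1) (tap n a) 0)
      else \<exists>h'\<ge>0. h' < int (length word) \<and>
        runs k (conf (Inc []) ?h (tap n a) 0) (length bs * ?B + 1)
          (conf Incr h' (tap n a) (int n - 1))"
      using Cons.prems total by (intro Cons.IH) auto
    have ext: "runs k (conf (Inc []) h (tap n a) 0) (length (b # bs) * ?B + 1) c"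
      if "runs k (conf (Inc []) ?h (tap n a) 0) (length bs * ?B + 1) c" for c
      by (rule runs_trans[OF first that]) simp
    have all: "(\<forall>b\<in>set (b # bs). \<not> violated k a b) \<longleftrightarrow> (\<forall>b\<in>set bs. \<not> violated k a b)"
      using False b by auto
    show ?thesis
      unfolding all using IH ext by (cases "\<forall>b\<in>set bs. \<not> violated k a b") (simp_all, blast)
  qed
qed

lemma runs_check:
  shows "good a \<Longrightarrow> runs k (conf (Inc []) (int n + 1) (tap n a) 0) check_time
      (conf Ext (int (length word) - 1) (tap n a) 0)"
    and "\<not> good a \<Longrightarrow> \<exists>h'\<ge>0. h' < int (length word) \<and>
      runs k (conf (Inc []) (int n + 1) (tap n a) 0) check_time (conf Incr h' (tap n a) (int n - 1))"
proof -
  have "inp (int n + 1 + int i) = code (concat (map (\<lambda>(fs, tt). fs @ tt) blocks) ! i)"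
    if "i < length (concat (map (\<lambda>(fs, tt). fs @ tt) blocks))" for i
    using inp_nth[of "n + 1 + i"] that by (simp add: word_def nth_append add.assoc add.left_commute)
  from runs_blocks[OF subset_refl _ this, of a]
  have *: "if \<forall>b\<in>set blocks. \<not> violated k a b
    then runs k (conf (Inc []) (int n + 1) (tap n a) 0) check_time
      (conf Ext (int (length word) - 1) (tap n a) 0)
    else \<exists>h'\<ge>0. h' < int (length word) \<and>
      runs k (conf (Inc []) (int n + 1) (tap n a) 0) check_time
        (conf Incr h' (tap n a) (int n - 1))"
    unfolding check_time_def by (simp add: word_def)
  show "good a \<Longrightarrow> runs k (conf (Inc []) (int n + 1) (tap n a) 0) check_time
      (conf Ext (int (length word) - 1) (tap n a) 0)"
    and "\<not> good a \<Longrightarrow> \<exists>h'\<ge>0. h' < int (length word) \<and>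
      runs k (conf (Inc []) (int n + 1) (tap n a) 0) check_time (conf Incr h' (tap n a) (int n - 1))"
    using * unfolding good_def by (simp_all split: if_splits)
qed

section \<open>Moves between nodes of the search tree\<close>

lemma runs_ext_skip:
  assumes "i \<le> length a" "length a \<le> n"
  shows "runs k (conf Ext h (tap n a) 0) i (conf Ext h (tap n a) (int i))"
  using assms(1)
proof (induction i)
  case 0
  then show ?case by (simp add: runs_refl)
next
  case (Suc i)
  have "runs k (conf Ext h (tap n a) (int i)) (Suc 0) (conf Ext h (tap n a) (int (Suc i)))"
    using Suc.prems assms(2)
    by (intro runs_conf[where T = 0 and q' = Ext and d = Stay and s = "tap n a (int i)" and e = Right])
       (auto simp: fun_upd_idem runs_refl add.commute, auto simp: tap_def code_def split: if_splits)
  with Suc show ?case by (auto intro: runs_trans)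
qed

lemma runs_ext_full:
  assumes "length a = n"
  shows "runs k (conf Ext h (tap n a) 0) (Suc n) (conf Acc h (tap n a) (int n))"
proof (rule runs_trans)
  show "runs k (conf Ext h (tap n a) 0) n (conf Ext h (tap n a) (int n))"
    using runs_ext_skip[of n a h] assms by simp
  show "runs k (conf Ext h (tap n a) (int n)) (Suc 0) (conf Acc h (tap n a) (int n))"
    by (intro runs_conf[where T = 0 and q' = Acc and d = Stay and s = 0 and e = Stay])
       (auto simp: runs_refl tap_def fun_upd_idem)
qed simp

lemma runs_ext_extend:
  assumes "length a < n"
  shows "runs k (conf Ext h (tap n a) 0) (Suc n) (conf Rew h (tap n (a @ [False])) (int (length a)))"
proof (rule runs_trans)
  show "runs k (conf Ext h (tap n a) 0) (length a) (conf Ext h (tap n a) (int (length a)))"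
    using runs_ext_skip[of "length a" a h] assms by simp
  have "(tap n a)(int (length a) := 1) = tap n (a @ [False])"
    using tap_append[OF assms, of False] by (simp add: code_def)
  then show "runs k (conf Ext h (tap n a) (int (length a))) (Suc 0)
      (conf Rew h (tap n (a @ [False])) (int (length a)))"
    using assms
    by (intro runs_conf[where T = 0 and q' = Rew and d = Stay and s = 1 and e = Stay])
       (auto simp: runs_refl tap_def)
qed (use assms in simp)

lemma runs_rewind:
  assumes "m \<le> length word"
  shows "runs k (conf Rew (int m - 1) g j) (Suc m) (conf Hdr 0 g j)"
  using assms
proof (induction m)
  case 0
  then show ?case
    by (intro runs_conf[where T = 0 and q' = Hdr and d = Right and s = "g j" and e = Stay])
       (auto simp: runs_refl inp_outside)
next
  case (Suc m)
  then have "runs k (conf Rew (int m - 1) g j) (Suc m) (conf Hdr 0 g j)" by simp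
  with Suc.prems show ?case
    by (intro runs_conf[where T = "Suc m" and q' = Rew and d = Left and s = "g j" and e = Stay])
       (auto simp: inp_nth code_def)
qed

lemma runs_header: "runs k (conf Hdr 0 g j) (Suc n) (conf Back (int n + 1) g j)"
proof -
  have "runs k (conf Hdr 0 g j) i (conf Hdr (int i) g j)" if "i \<le> n" for i
    using that
  proof (induction i)
    case 0
    then show ?case by (simp add: runs_refl)
  next
    case (Suc i)
    then have "runs k (conf Hdr (int i) g j) (Suc 0) (conf Hdr (int (Suc i)) g j)"
      by (intro runs_conf[where T = 0 and q' = Hdr and d = Right and s = "g j" and e = Stay])
         (auto simp: runs_refl inp_header add.commute)
    with Suc show ?case by (auto intro: runs_trans)
  qed
  moreover have "runs k (conf Hdr (int n) g j) (Suc 0) (conf Back (int n + 1) g j)"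
    by (intro runs_conf[where T = 0 and q' = Back and d = Right and s = "g j" and e = Stay])
       (auto simp: runs_refl inp_header)
  ultimately show ?thesis by (rule runs_trans[OF _ _ order_eq_refl]) simp_all
qed

text \<open>\<open>Rew\<close> takes at most \<open>length word + 1\<close> steps,
  \<open>Hdr\<close> takes \<open>n + 1\<close>, and \<open>Back\<close> at most
  \<open>n + 1\<close>.\<close>

lemma runs_restart:
  assumes "0 \<le> h" "h < int (length word)" "j < n"
  shows "runs k (conf Rew h (tap n a) (int j)) (length word + 2 * n + 3)
    (conf (Inc []) (int n + 1) (tap n a) 0)"
proof -
  define m where "m = nat (h + 1)"
  have m: "m \<le> length word" "h = int m - 1"
    using assms by (simp_all add: m_def)
  have "runs k (conf Rew h (tap n a) (int j)) (length word + 1) (conf Hdr 0 (tap n a) (int j))"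
    using runs_mono[OF runs_rewind[OF m(1)]] m by simp
  moreover have "runs k (conf Back (int n + 1) (tap n a) (int j)) (Suc (Suc j))
      (conf (Inc []) (int n + 1) (tap n a) 0)"
    using runs_back[of "Suc j" "tap n a" "int n + 1"] assms(3) by (auto simp: tap_def code_def)
  then have "runs k (conf Hdr 0 (tap n a) (int j)) (2 * n + 2) (conf (Inc []) (int n + 1) (tap n a) 0)"
    using assms(3) by (intro runs_trans[OF runs_header]) auto
  ultimately show ?thesis by (rule runs_trans) simp
qed

text \<open>A failed check leaves the head of tape 2 at the right end. The rule of
  \<open>Incr\<close> that erases a \<open>True\<close> also crosses unassigned cells, since it
  writes 3 over 3.\<close>

lemma runs_incr_skip:
  assumes "length a + m \<le> n"
  shows "runs k (conf Incr h (tap n a) (int (length a + m) - 1)) m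
    (conf Incr h (tap n a) (int (length a) - 1))"
  using assms
proof (induction m)
  case 0
  then show ?case by (simp add: runs_refl)
next
  case (Suc m)
  then show ?case
    by (intro runs_conf[where T = m and q' = Incr and d = Stay and s = 3 and e = Left])
       (auto simp: tap_def fun_upd_idem)
qed

text \<open>The number of nodes of the search tree below \<open>a\<close>, cut off at depth \<open>d\<close>.\<close>

fun tree_size :: "nat \<Rightarrow> bool list \<Rightarrow> nat" where
  "tree_size 0 a = 1"
| "tree_size (Suc d) a =
     (if good a then 1 + tree_size d (a @ [False]) + tree_size d (a @ [True]) else 1)"

text \<open>The exact sum of the costs charged to a good inner node on which both subtrees fail: the
  check, \<open>n + 1\<close> steps to append \<open>False\<close>, a restart, the flip to
  \<open>True\<close> with a second restart, and one step to erase \<open>True\<close>. Every other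
  kind of node costs less.\<close>

definition node_time :: nat where
  "node_time = check_time + 2 * length word + 5 * n + 9"

text \<open>The failing case is what makes the recursion compose: a failed subtree restores tape 2
  to \<open>a\<close> and leaves \<open>Incr\<close> on the last cell of \<open>a\<close>, which is
  where the parent flips \<open>False\<close> or erases \<open>True\<close>. After a success the
  machine has halted, so the rest of the configuration is left open.\<close>

lemma runs_subtree:
  assumes "length a + d = n"
  shows "if \<exists>c. length c = d \<and> good (a @ c)
    then \<exists>h g j. runs k (conf (Inc []) (int n + 1) (tap n a) 0) (node_time * tree_size d a) (conf Acc h g j)
    else \<exists>h'\<ge>0. h' < int (length word) \<and>
      runs k (conf (Inc []) (int n + 1) (tap n a) 0) (node_time * tree_size d a)
        (conf Incr h' (tap n a) (int (length a) - 1))"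
  using assms
proof (induction d arbitrary: a)
  case (0 a)
  show ?case
  proof (cases "good a")
    case True
    have "runs k (conf (Inc []) (int n + 1) (tap n a) 0) (node_time * tree_size 0 a)
        (conf Acc (int (length word) - 1) (tap n a) (int n))"
      by (rule runs_trans[OF runs_check(1)[OF True] runs_ext_full]) (use 0 in \<open>simp_all add: node_time_def\<close>)
    with True show ?thesis by auto
  next
    case False
    then obtain h' where "h' \<ge> 0" "h' < int (length word)"
      "runs k (conf (Inc []) (int n + 1) (tap n a) 0) check_time (conf Incr h' (tap n a) (int n - 1))"
      using runs_check(2) by blast
    with False 0 show ?thesis
      by (auto intro!: exI[of _ h'] elim!: runs_mono simp: node_time_def)
  qed
next
  case (Suc d a)
  have sub: "(\<exists>c. length c = Suc d \<and> good (a @ c)) \<longleftrightarrow>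
      (\<exists>c. length c = d \<and> good ((a @ [False]) @ c)) \<or> (\<exists>c. length c = d \<and> good ((a @ [True]) @ c))"
    by (auto simp: length_Suc_conv) (metis (full_types))
  show ?case
  proof (cases "good a")
    case False
    then obtain h' where h': "h' \<ge> 0" "h' < int (length word)"
      "runs k (conf (Inc []) (int n + 1) (tap n a) 0) check_time (conf Incr h' (tap n a) (int n - 1))"
      using runs_check(2) by blast
    \<comment> \<open>A bad node has no children; the \<open>Suc d\<close> unassigned cells to the
      right of \<open>a\<close> are crossed at a cost that \<open>node_time\<close> covers.\<close>
    have "runs k (conf (Inc []) (int n + 1) (tap n a) 0) (node_time * tree_size (Suc d) a)
        (conf Incr h' (tap n a) (int (length a) - 1))"
      using Suc.prems False runs_incr_skip[of a "Suc d" h']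
      by (intro runs_trans[OF h'(3), where T' = "Suc d"]) (simp_all add: node_time_def)
    moreover have "\<nexists>c. length c = Suc d \<and> good (a @ c)"
      using False good_append by blast
    ultimately show ?thesis using h' by auto
  next
    case True
    let ?aF = "a @ [False]" and ?aT = "a @ [True]"
    let ?sF = "tree_size d ?aF" and ?sT = "tree_size d ?aT"
    let ?L = "int (length word)"
    have len: "length a < n" "length ?aF + d = n" "length ?aT + d = n"
      using Suc.prems by auto
    have total: "node_time * tree_size (Suc d) a = node_time + node_time * ?sF + node_time * ?sT"
      using True by (simp add: algebra_simps)
    define T1 where "T1 = check_time + Suc n + (length word + 2 * n + 3)"
    have L: "0 \<le> ?L - 1" "?L - 1 < ?L" using length_word_gt by auto
    have "runs k (conf (Inc []) (int n + 1) (tap n a) 0) (check_time + Suc n)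
        (conf Rew (?L - 1) (tap n ?aF) (int (length a)))"
      by (rule runs_trans[OF runs_check(1)[OF True] runs_ext_extend[OF len(1)]]) simp
    then have enterF: "runs k (conf (Inc []) (int n + 1) (tap n a) 0) T1
        (conf (Inc []) (int n + 1) (tap n ?aF) 0)"
      by (rule runs_trans[OF _ runs_restart[OF L len(1)]]) (simp add: T1_def)
    show ?thesis
    proof (cases "\<exists>c. length c = d \<and> good (?aF @ c)")
      case F: True
      then obtain h g j where "runs k (conf (Inc []) (int n + 1) (tap n ?aF) 0) (node_time * ?sF) (conf Acc h g j)"
        using Suc.IH[OF len(2), unfolded if_P[OF F]] by blast
      then have "runs k (conf (Inc []) (int n + 1) (tap n a) 0) (node_time * tree_size (Suc d) a) (conf Acc h g j)"
        by (rule runs_trans[OF enterF]) (unfold total, simp add: T1_def node_time_def)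
      moreover have "\<exists>c. length c = Suc d \<and> good (a @ c)" using F sub by blast
      ultimately show ?thesis by (auto simp del: tree_size.simps)
    next
      case F: False
      then obtain h1 where h1: "h1 \<ge> 0" "h1 < ?L" and
        r1: "runs k (conf (Inc []) (int n + 1) (tap n ?aF) 0) (node_time * ?sF)
          (conf Incr h1 (tap n ?aF) (int (length a)))"
        using Suc.IH[OF len(2), unfolded if_not_P[OF F]] by auto
      have "(tap n ?aF)(int (length a) := 2) = tap n ?aT"
        using tap_replace[OF len(1), of False True] by (simp add: code_def)
      then have flip: "runs k (conf Incr h1 (tap n ?aF) (int (length a))) (Suc 0)
          (conf Rew h1 (tap n ?aT) (int (length a)))"
        using len(1)
        by (intro runs_conf[where T = 0 and q' = Rew and d = Stay and s = 2 and e = Stay])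
           (auto simp: runs_refl tap_def code_def)
      have "runs k (conf Incr h1 (tap n ?aF) (int (length a))) (length word + 2 * n + 4)
          (conf (Inc []) (int n + 1) (tap n ?aT) 0)"
        by (rule runs_trans[OF flip runs_restart[OF h1 len(1)]]) simp
      then have "runs k (conf (Inc []) (int n + 1) (tap n ?aF) 0) (node_time * ?sF + (length word + 2 * n + 4))
          (conf (Inc []) (int n + 1) (tap n ?aT) 0)"
        by (rule runs_trans[OF r1]) simp
      then have enterT: "runs k (conf (Inc []) (int n + 1) (tap n a) 0)
          (T1 + node_time * ?sF + (length word + 2 * n + 4)) (conf (Inc []) (int n + 1) (tap n ?aT) 0)"
        by (rule runs_trans[OF enterF]) simp
      show ?thesis
      proof (cases "\<exists>c. length c = d \<and> good (?aT @ c)")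
        case T: True
        then obtain h g j where "runs k (conf (Inc []) (int n + 1) (tap n ?aT) 0) (node_time * ?sT) (conf Acc h g j)"
          using Suc.IH[OF len(3), unfolded if_P[OF T]] by blast
        then have "runs k (conf (Inc []) (int n + 1) (tap n a) 0)
            (node_time * tree_size (Suc d) a) (conf Acc h g j)"
          by (rule runs_trans[OF enterT]) (unfold total, simp add: T1_def node_time_def)
        moreover have "\<exists>c. length c = Suc d \<and> good (a @ c)" using T sub by blast
        ultimately show ?thesis by (auto simp del: tree_size.simps)
      next
        case T: False
        then obtain h2 where h2: "h2 \<ge> 0" "h2 < ?L" and
          r2: "runs k (conf (Inc []) (int n + 1) (tap n ?aT) 0) (node_time * ?sT)
            (conf Incr h2 (tap n ?aT) (int (length a)))"
          using Suc.IH[OF len(3), unfolded if_not_P[OF T]] by auto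
        have drop: "runs k (conf Incr h2 (tap n ?aT) (int (length a))) (Suc 0)
            (conf Incr h2 (tap n a) (int (length a) - 1))"
          using len(1) tap_remove[OF len(1), of True]
          by (intro runs_conf[where T = 0 and q' = Incr and d = Stay and s = 3 and e = Left])
             (auto simp: runs_refl tap_def code_def)
        have "runs k (conf (Inc []) (int n + 1) (tap n ?aT) 0) (node_time * ?sT + 1)
            (conf Incr h2 (tap n a) (int (length a) - 1))"
          by (rule runs_trans[OF r2 drop]) simp
        then have "runs k (conf (Inc []) (int n + 1) (tap n a) 0) (node_time * tree_size (Suc d) a)
            (conf Incr h2 (tap n a) (int (length a) - 1))"
          by (rule runs_trans[OF enterT]) (unfold total, simp add: T1_def node_time_def)
        moreover have "\<not> (\<exists>c. length c = Suc d \<and> good (a @ c))"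
          using F T sub by blast
        ultimately show ?thesis using h2 by (auto simp del: tree_size.simps)
      qed
    qed
  qed
qed

text \<open>Besides the search: \<open>n + 1\<close> steps to copy the header, \<open>n + 1\<close>
  to return on tape 2, and one to reject.\<close>

definition total_time :: nat where
  "total_time = 2 * n + 3 + node_time * tree_size n []"

lemma runs_from_start:
  "if \<exists>a. length a = n \<and> good a
    then \<exists>h g j. runs k (conf Init 0 (\<lambda>_. 0) 0) total_time (conf Acc h g j)
    else \<exists>h g j. runs k (conf Init 0 (\<lambda>_. 0) 0) total_time (conf Rej h g j)"
proof -
  have start: "runs k (conf Init 0 (\<lambda>_. 0) 0) (2 * n + 2) (conf (Inc []) (int n + 1) (tap n []) 0)"
    by (rule runs_trans[OF runs_init runs_back]) (auto simp: tap_def)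
  show ?thesis
  proof (cases "\<exists>a. length a = n \<and> good a")
    case True
    then obtain h g j where
      "runs k (conf (Inc []) (int n + 1) (tap n []) 0) (node_time * tree_size n []) (conf Acc h g j)"
      using runs_subtree[of "[]" n] by (auto split: if_splits)
    then have "runs k (conf Init 0 (\<lambda>_. 0) 0) total_time (conf Acc h g j)"
      by (rule runs_trans[OF start]) (simp add: total_time_def)
    with True show ?thesis by auto
  next
    case False
    then obtain h where r: "runs k (conf (Inc []) (int n + 1) (tap n []) 0)
        (node_time * tree_size n []) (conf Incr h (tap n []) (- 1))"
      using runs_subtree[of "[]" n] by (auto split: if_splits)
    \<comment> \<open>When the root fails, \<open>Incr\<close> stands on the blank left of cell 0:
      no \<open>False\<close> remains to be flipped.\<close>
    have "runs k (conf Incr h (tap n []) (- 1)) (Suc 0) (conf Rej h (tap n []) (- 1))"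
      by (intro runs_conf[where T = 0 and q' = Rej and d = Stay and s = 0 and e = Stay])
         (auto simp: runs_refl tap_def fun_upd_idem)
    from runs_trans[OF r this order_refl]
    have "runs k (conf Init 0 (\<lambda>_. 0) 0) total_time (conf Rej h (tap n []) (- 1))"
      by (rule runs_trans[OF start]) (simp add: total_time_def)
    with False show ?thesis by auto
  qed
qed

lemma init_config_word: "init_config (search_tm k) word = conf Init 0 (\<lambda>_. 0) 0"
  by (simp add: init_config_def inp_def search_tm_simps input_tape_def)

lemma machine_correct:
  "halts_within (search_tm k) word total_time"
  "tm_accepts (search_tm k) word \<longleftrightarrow> (\<exists>a. length a = n \<and> good a)"
proof -
  let ?sat = "\<exists>a. length a = n \<and> good a"
  define q where "q = (if ?sat then Acc else Rej)"
  obtain t where t: "t \<le> total_time" "state_after (search_tm k) word t = to_nat q"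
  proof -
    obtain h g j where "runs k (conf Init 0 (\<lambda>_. 0) 0) total_time (conf q h g j)"
      using runs_from_start unfolding q_def by (cases ?sat) (simp_all only: if_True if_False, blast+)
    then obtain t where "t \<le> total_time" "(step (search_tm k) ^^ t) (conf Init 0 (\<lambda>_. 0) 0) = conf q h g j"
      unfolding runs_def by blast
    with that show ?thesis
      by (simp add: state_after_def init_config_word)
  qed
  have q: "to_nat q \<in> {accept (search_tm k), reject (search_tm k)}"
    by (auto simp: q_def search_tm_simps)
  with t show "halts_within (search_tm k) word total_time"
    unfolding halts_within_def by auto
  have "to_nat q = accept (search_tm k)" if "tm_accepts (search_tm k) word"
  proof -
    from that obtain u where u: "state_after (search_tm k) word u = accept (search_tm k)"
      unfolding tm_accepts_def by blast
    \<comment> \<open>Both verdicts persist up to the later of the two times, so they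
      coincide.\<close>
    have "state_after (search_tm k) word (max t u) = to_nat q"
      "state_after (search_tm k) word (max t u) = accept (search_tm k)"
      using halting_fixed[of "search_tm k" word t "max t u"]
        halting_fixed[of "search_tm k" word u "max t u"] t(2) u q by simp_all
    then show ?thesis by simp
  qed
  then show "tm_accepts (search_tm k) word \<longleftrightarrow> ?sat"
    using t unfolding tm_accepts_def by (auto simp: q_def search_tm_simps split: if_splits)
qed

text \<open>A node other than the root is one of the two children of a good node. Nodes at the
  cut-off depth have no children, so only good extensions shorter than \<open>d\<close>
  count.\<close>

lemma tree_size_le: "tree_size d a \<le> 1 + 2 * card {c. length c < d \<and> good (a @ c)}"
proof (induction d arbitrary: a)
  case (Suc d)
  let ?G = "\<lambda>d a. {c. length c < d \<and> good (a @ c)}"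
  have fin: "finite (?G d a)" for d a
    by (rule finite_subset[OF _ finite_lists_length_le[of UNIV d]]) auto
  show ?case
  proof (cases "good a")
    case True
    have "insert [] (Cons False ` ?G d (a @ [False]) \<union> Cons True ` ?G d (a @ [True])) \<subseteq> ?G (Suc d) a"
      using True by auto
    then have "card (insert [] (Cons False ` ?G d (a @ [False]) \<union> Cons True ` ?G d (a @ [True])))
        \<le> card (?G (Suc d) a)"
      by (rule card_mono[OF fin])
    moreover have "card (insert [] (Cons False ` ?G d (a @ [False]) \<union> Cons True ` ?G d (a @ [True])))
        = 1 + (card (?G d (a @ [False])) + card (?G d (a @ [True])))"
    proof -
      have "finite (Cons b ` ?G d (a @ [b]))" "card (Cons b ` ?G d (a @ [b])) = card (?G d (a @ [b]))" for b
        using fin by (blast, simp add: card_image)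
      then show ?thesis
        by (subst card_insert_disjoint, blast, blast, subst card_Un_disjoint) auto
    qed
    ultimately show ?thesis
      using True Suc.IH[of "a @ [False]"] Suc.IH[of "a @ [True]"] by simp
  qed simp
qed simp

end

section \<open>Counting partial solutions\<close>

text \<open>A weak form of the Sauer-Shelah lemma: \<open>A\<close> collects the tails of members of \<open>F\<close> and \<open>B\<close> the
  tails that occur with both heads, so that \<open>card F = card A + card B\<close>, and \<open>B\<close> shatters only sets
  of size smaller by one.\<close>

lemma card_le_if_not_shattered:
  fixes F :: "bool list set"
  assumes "\<And>xs. xs \<in> F \<Longrightarrow> length xs = n"
    and "\<And>S. S \<subseteq> {..<n} \<Longrightarrow> card S = k \<Longrightarrow> \<exists>p. \<forall>xs\<in>F. \<exists>j\<in>S. xs ! j \<noteq> p j"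
  shows "card F \<le> (n + 1) ^ k"
  using assms
proof (induction n arbitrary: F k)
  case 0
  then have "F \<subseteq> {[]}" by auto
  then have "card F \<le> card {[] :: bool list}" by (intro card_mono) auto
  then show ?case by simp
next
  case (Suc n)
  show ?case
  proof (cases k)
    case 0
    \<comment> \<open>No list can disagree with a pattern on the empty set.\<close>
    then have "F = {}" using Suc.prems(2)[of "{}"] by auto
    then show ?thesis by simp
  next
    case (Suc k')
    define G where "G b = {xs. b # xs \<in> F}" for b
    let ?A = "G False \<union> G True" and ?B = "G False \<inter> G True"
    have fin: "finite (G b)" for b
      by (rule finite_subset[OF _ finite_lists_length_eq[of UNIV n]])
         (auto simp: G_def dest: Suc.prems(1))
    have "F = Cons False ` G False \<union> Cons True ` G True"
    proof
      show "F \<subseteq> Cons False ` G False \<union> Cons True ` G True"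
      proof
        fix xs assume xs: "xs \<in> F"
        then obtain b ys where "xs = b # ys"
          using Suc.prems(1)[OF xs] by (cases xs) auto
        with xs show "xs \<in> Cons False ` G False \<union> Cons True ` G True"
          by (cases b) (auto simp: G_def)
      qed
    qed (auto simp: G_def)
    moreover have "card (Cons False ` G False \<union> Cons True ` G True) =
        card (Cons False ` G False) + card (Cons True ` G True)"
      using fin by (intro card_Un_disjoint) auto
    ultimately have "card F = card (G False) + card (G True)"
      by (simp add: card_image)
    then have split: "card F = card ?A + card ?B"
      using card_Un_Int[of "G False" "G True"] fin by simp
    have A: "card ?A \<le> (n + 1) ^ k"
    proof (rule Suc.IH)
      fix S assume S: "S \<subseteq> {..<n}" "card S = k"
      have "Suc ` S \<subseteq> {..<Suc n}" "card (Suc ` S) = k"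
        using S by (auto simp: card_image)
      then obtain p where "\<forall>xs\<in>F. \<exists>j\<in>Suc ` S. xs ! j \<noteq> p j"
        using Suc.prems(2) by blast
      then show "\<exists>p. \<forall>xs\<in>?A. \<exists>j\<in>S. xs ! j \<noteq> p j"
        by (intro exI[of _ "p \<circ> Suc"]) (fastforce simp: G_def)
    qed (auto simp: G_def dest: Suc.prems(1))
    have B: "card ?B \<le> (n + 1) ^ k'"
    proof (rule Suc.IH)
      fix S assume S: "S \<subseteq> {..<n}" "card S = k'"
      have "finite S" using S finite_subset by blast
      then have "insert 0 (Suc ` S) \<subseteq> {..<Suc n}" "card (insert 0 (Suc ` S)) = k"
        using S Suc by (auto simp: card_image)
      then obtain p where p: "\<forall>xs\<in>F. \<exists>j\<in>insert 0 (Suc ` S). xs ! j \<noteq> p j"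
        using Suc.prems(2) by blast
      have "\<exists>j\<in>S. xs ! j \<noteq> p (Suc j)" if "xs \<in> ?B" for xs
      proof -
        \<comment> \<open>A tail in \<open>?B\<close> occurs with both heads, so it may be given the
          head that agrees with \<open>p\<close>; the disagreement is then forced into the
          tail.\<close>
        have "p 0 # xs \<in> F" using that by (cases "p 0") (auto simp: G_def)
        with p obtain j where "j \<in> insert 0 (Suc ` S)" "(p 0 # xs) ! j \<noteq> p j" by blast
        then obtain i where "i \<in> S" "j = Suc i" by (metis imageE insertE nth_Cons_0)
        with \<open>(p 0 # xs) ! j \<noteq> p j\<close> show ?thesis by (metis nth_Cons_Suc)
      qed
      then show "\<exists>p. \<forall>xs\<in>?B. \<exists>j\<in>S. xs ! j \<noteq> p j"
        by (intro exI[of _ "p \<circ> Suc"]) auto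
    qed (auto simp: G_def dest: Suc.prems(1))
    \<comment> \<open>The two bounds share the factor \<open>(n + 1) ^ k'\<close>; raising its base
      to \<open>n + 2\<close> completes the power.\<close>
    have "card F \<le> (n + 1) ^ k' * (n + 2)"
      using A B split Suc by (simp add: algebra_simps)
    also have "\<dots> \<le> (n + 2) ^ k' * (n + 2)"
      by (intro mult_right_mono power_mono) auto
    also have "\<dots> = (Suc n + 1) ^ k" using Suc by simp
    finally show ?thesis .
  qed
qed

section \<open>Encoded instances\<close>

text \<open>Pascal's rule, splitting on whether the first element is taken, with the same arithmetic
  as in the counting lemma.\<close>

lemma length_subseqs_length_le: "length (filter (\<lambda>xs. length xs = k) (subseqs vs)) \<le> (length vs + 1) ^ k"
proof (induction vs arbitrary: k)
  case (Cons v vs)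
  show ?case
  proof (cases k)
    case 0
    have "filter (\<lambda>xs. length xs = 0) (map ((#) v) (subseqs vs)) = []"
      by (simp add: filter_empty_conv)
    with Cons[of 0] 0 show ?thesis by (simp add: Let_def)
  next
    case (Suc k')
    have "length (filter (\<lambda>xs. length xs = k) (subseqs (v # vs))) \<le> (length vs + 1) ^ k' * (length vs + 2)"
      using Cons[of k'] Cons[of k] Suc by (simp add: Let_def filter_map comp_def algebra_simps)
    also have "\<dots> \<le> (length vs + 2) ^ k' * (length vs + 2)"
      by (intro mult_right_mono power_mono) auto
    also have "\<dots> = (length (v # vs) + 1) ^ k" using Suc by simp
    finally show ?thesis .
  qed
qed simp

text \<open>A sublist of a distinct list is determined by its elements; this links the sublists in
  the encoding to scopes as sets.\<close>

lemma filter_mem_subseqs: "xs \<in> set (subseqs vs) \<Longrightarrow> distinct vs \<Longrightarrow> filter (\<lambda>v. v \<in> set xs) vs = xs"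
proof (induction vs arbitrary: xs)
  case (Cons v vs)
  have sub: "ys \<in> set (subseqs vs) \<Longrightarrow> set ys \<subseteq> set vs" for ys
    using subseqs_powset[of vs] by blast
  from Cons.prems(1) consider ys where "xs = v # ys" "ys \<in> set (subseqs vs)" | "xs \<in> set (subseqs vs)"
    by (auto simp: Let_def)
  then show ?case
  proof cases
    case 1
    then have "filter (\<lambda>u. u \<in> set xs) vs = filter (\<lambda>u. u \<in> set ys) vs"
      using Cons.prems(2) by (intro filter_cong) auto
    with 1 Cons show ?thesis by simp
  next
    case 2
    then have "v \<notin> set xs" using sub Cons.prems(2) by auto
    with 2 Cons show ?thesis by simp
  qed
qed simp

lemma selected_filter:
  assumes "\<And>j. j < length vs \<Longrightarrow> Q (vs ! j) \<Longrightarrow> j < length a \<and> a ! j = \<alpha> (vs ! j)"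
  shows "selected (map Q vs) a = map \<alpha> (filter Q vs)"
  using assms
proof (induction vs arbitrary: a)
  case (Cons v vs)
  note prems = Cons.prems
  show ?case
  proof (cases a)
    case Nil
    have "\<not> Q u" if "u \<in> set (v # vs)" for u
      using that prems Nil by (metis in_set_conv_nth less_nat_zero_code list.size(3))
    then have "filter Q (v # vs) = []" by (simp only: filter_empty_conv) blast
    then show ?thesis using Nil by (simp only: selected_simps list.map)
  next
    case (Cons b a')
    have "selected (map Q vs) a' = map \<alpha> (filter Q vs)"
      using prems[of "Suc j" for j] Cons by (intro Cons.IH) auto
    with prems[of 0] Cons show ?thesis by auto
  qed
qed simp

lemma list_assignment_map: "list_assignment xs (map \<alpha> xs) = restrict \<alpha> (set xs)"
  by (auto simp: list_assignment_def map_of_zip_map fun_eq_iff)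

text \<open>The machine and the encoding enumerate rows by the same list, so any row equal to
  \<open>bs\<close> holds the value of the constraint at \<open>bs\<close>.\<close>

lemma violated_truth_table:
  assumes "selected fs a = bs" "length bs = k" "length xs = k"
  shows "violated k a (fs, truth_table P xs) \<longleftrightarrow> \<not> P (set xs) (list_assignment xs bs)"
proof -
  let ?L = "List.n_lists k [False, True]"
  have len: "length ?L = 2 ^ k" by (simp add: length_n_lists numeral_2_eq_2)
  have "bs \<in> set ?L" using assms(2) by (auto simp: set_n_lists)
  then obtain i where i: "i < 2 ^ k" "?L ! i = bs" by (metis in_set_conv_nth len)
  have "truth_table P xs ! j = P (set xs) (list_assignment xs (?L ! j))" if "j < 2 ^ k" for j
    using that len assms(3) by (simp add: truth_table_def)
  then show ?thesis
    using i assms(1,2) by (auto simp: violated_def)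
qed

definition csp_blocks :: "nat \<Rightarrow> nat set \<Rightarrow> constraints \<Rightarrow> (bool list \<times> bool list) list" where
  "csp_blocks k V P = (let vs = sorted_list_of_set V in
     map (\<lambda>xs. (map (\<lambda>v. v \<in> set xs) vs, truth_table P xs)) (filter (\<lambda>xs. length xs = k) (subseqs vs)))"

lemma length_sorted_list: "length (sorted_list_of_set V) = card V" for V :: "nat set"
  by (cases "finite V") auto

lemma encoded_csp_blocks: "encoded k (card V) (csp_blocks k V P)"
  by unfold_locales
     (auto simp: csp_blocks_def Let_def truth_table_def length_n_lists numeral_2_eq_2 length_sorted_list)

lemma word_csp_blocks: "encoded.word (card V) (csp_blocks k V P) = encode_csp k V P"
  unfolding encoded.word_def[OF encoded_csp_blocks]
  by (simp add: csp_blocks_def encode_csp_def Let_def comp_def encode_constraint_def[abs_def])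

section \<open>Correctness and running time for a complete instance\<close>

locale csp =
  fixes k :: nat and V :: "nat set" and P :: constraints
  assumes complete: "complete_csp k V P"
begin

abbreviation "vs \<equiv> sorted_list_of_set V"

sublocale encoded k "card V" "csp_blocks k V P"
  by (rule encoded_csp_blocks)

lemma finite_V: "finite V"
  using complete by (simp add: complete_csp_def)

text \<open>Since \<open>vs\<close> is distinct, its sublists of length \<open>k\<close> correspond
  to the scopes, by \<open>set\<close> in one direction and by filtering in the other.\<close>

lemma good_iff:
  "good a \<longleftrightarrow> (\<forall>S\<in>scopes k V. \<not> violated k a
     (map (\<lambda>v. v \<in> S) vs, truth_table P (filter (\<lambda>v. v \<in> S) vs)))"
proof -
  let ?b = "\<lambda>xs. (map (\<lambda>v. v \<in> set xs) vs, truth_table P xs)"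
  have subs: "set xs \<in> scopes k V" "filter (\<lambda>v. v \<in> set xs) vs = xs"
    if "xs \<in> set (subseqs vs)" "length xs = k" for xs
  proof -
    show xs: "filter (\<lambda>v. v \<in> set xs) vs = xs"
      using filter_mem_subseqs[OF that(1)] by simp
    have "set xs \<subseteq> V" using xs finite_V by (metis filter_is_subset set_sorted_list_of_set)
    moreover have "distinct xs" using xs by (metis distinct_filter distinct_sorted_list_of_set)
    ultimately show "set xs \<in> scopes k V"
      using that(2) by (simp add: scopes_def distinct_card)
  qed
  have scope: "set (filter (\<lambda>v. v \<in> S) vs) = S" "length (filter (\<lambda>v. v \<in> S) vs) = k"
    "filter (\<lambda>v. v \<in> S) vs \<in> set (subseqs vs)"
    if "S \<in> scopes k V" for S
  proof -
    show S: "set (filter (\<lambda>v. v \<in> S) vs) = S"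
      using that finite_V by (auto simp: scopes_def)
    then show "length (filter (\<lambda>v. v \<in> S) vs) = k"
      using that by (metis (mono_tags, lifting) distinct_card distinct_filter
          distinct_sorted_list_of_set mem_Collect_eq scopes_def)
    show "filter (\<lambda>v. v \<in> S) vs \<in> set (subseqs vs)"
      by (simp add: set_subseqs_eq)
  qed
  have "good a \<longleftrightarrow> (\<forall>xs\<in>set (subseqs vs). length xs = k \<longrightarrow> \<not> violated k a (?b xs))"
  proof -
    have "set (csp_blocks k V P) = ?b ` {xs \<in> set (subseqs vs). length xs = k}"
      by (simp add: csp_blocks_def Let_def)
    then show ?thesis by (simp add: good_def set_subseqs_eq) blast
  qed
  also have "\<dots> \<longleftrightarrow> (\<forall>S\<in>scopes k V. \<not> violated k a
     (map (\<lambda>v. v \<in> S) vs, truth_table P (filter (\<lambda>v. v \<in> S) vs)))" (is "?L \<longleftrightarrow> ?R")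
  proof
    assume L: ?L
    show ?R
    proof
      fix S assume S: "S \<in> scopes k V"
      show "\<not> violated k a (map (\<lambda>v. v \<in> S) vs, truth_table P (filter (\<lambda>v. v \<in> S) vs))"
        using L[rule_format, OF scope(3,2)[OF S]] unfolding scope(1)[OF S] .
    qed
  next
    assume R: ?R
    show ?L
    proof (intro ballI impI)
      fix xs assume xs: "xs \<in> set (subseqs vs)" "length xs = k"
      show "\<not> violated k a (?b xs)"
        using R[rule_format, OF subs(1)[OF xs]] unfolding subs(2)[OF xs] .
    qed
  qed
  finally show ?thesis .
qed

text \<open>Agreement with \<open>\<alpha>\<close> is asked on the scope alone, so this serves full
  solutions as well as partial assignments that cover the scope.\<close>

lemma violated_scope:
  assumes "S \<in> scopes k V"
    and "\<And>j. j < card V \<Longrightarrow> vs ! j \<in> S \<Longrightarrow> j < length a \<and> a ! j = \<alpha> (vs ! j)"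
  shows "violated k a (map (\<lambda>v. v \<in> S) vs, truth_table P (filter (\<lambda>v. v \<in> S) vs)) \<longleftrightarrow>
    \<not> P S (restrict \<alpha> S)"
proof -
  let ?xs = "filter (\<lambda>v. v \<in> S) vs"
  have S: "set ?xs = S"
    using assms(1) finite_V by (auto simp: scopes_def)
  have len: "length ?xs = k"
    using distinct_card[of ?xs] assms(1) unfolding S by (simp add: scopes_def)
  have "selected (map (\<lambda>v. v \<in> S) vs) a = map \<alpha> ?xs"
    using assms(2) by (intro selected_filter) (auto simp: length_sorted_list)
  from violated_truth_table[OF this _ len] len show ?thesis
    by (simp only: length_map S list_assignment_map)
qed

lemma satisfiable_iff: "csp_satisfiable k V P \<longleftrightarrow> (\<exists>a. length a = card V \<and> good a)"
proof
  assume "csp_satisfiable k V P"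
  then obtain \<alpha> where \<alpha>: "\<forall>S\<in>scopes k V. P S (restrict \<alpha> S)"
    by (auto simp: csp_satisfiable_def)
  have "good (map \<alpha> vs)"
    unfolding good_iff
  proof
    fix S assume S: "S \<in> scopes k V"
    have "violated k (map \<alpha> vs) (map (\<lambda>v. v \<in> S) vs, truth_table P (filter (\<lambda>v. v \<in> S) vs)) \<longleftrightarrow>
        \<not> P S (restrict \<alpha> S)"
      by (rule violated_scope[OF S]) (simp add: length_sorted_list)
    with \<alpha> S show "\<not> violated k (map \<alpha> vs) (map (\<lambda>v. v \<in> S) vs, truth_table P (filter (\<lambda>v. v \<in> S) vs))"
      by blast
  qed
  then show "\<exists>a. length a = card V \<and> good a"
    by (intro exI[of _ "map \<alpha> vs"]) (simp add: length_sorted_list)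
next
  assume "\<exists>a. length a = card V \<and> good a"
  then obtain a where a: "length a = card V" "good a" by blast
  \<comment> \<open>Restricting to \<open>V\<close> makes the assignment extensional, as
    \<open>csp_satisfiable\<close> demands.\<close>
  define \<alpha> where "\<alpha> = restrict (\<lambda>v. the (map_of (zip vs a) v)) V"
  have "P S (restrict \<alpha> S)" if S: "S \<in> scopes k V" for S
  proof -
    have "j < length a \<and> a ! j = \<alpha> (vs ! j)" if "j < card V" for j
    proof -
      have "vs ! j \<in> V"
        using that finite_V by (metis length_sorted_list nth_mem set_sorted_list_of_set)
      then show ?thesis
        using that a(1) by (simp add: \<alpha>_def map_of_zip_nth length_sorted_list)
    qed
    then have "violated k a (map (\<lambda>v. v \<in> S) vs, truth_table P (filter (\<lambda>v. v \<in> S) vs)) \<longleftrightarrow>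
        \<not> P S (restrict \<alpha> S)"
      by (intro violated_scope[OF S]) blast
    with a(2) S show ?thesis unfolding good_iff by blast
  qed
  moreover have "\<alpha> \<in> V \<rightarrow>\<^sub>E UNIV" by (simp add: \<alpha>_def)
  ultimately show "csp_satisfiable k V P" unfolding csp_satisfiable_def by blast
qed

text \<open>Completeness and nontriviality enter here. Any \<open>k\<close> of the first
  \<open>i\<close> positions name a scope, and its constraint rejects some pattern. An assignment of
  length \<open>i\<close> covers this scope, so a good one must avoid the pattern: the positions are
  not shattered.\<close>

lemma card_good_le:
  assumes "i \<le> card V"
  shows "card {a. length a = i \<and> good a} \<le> (i + 1) ^ k"
proof (rule card_le_if_not_shattered)
  fix T assume T: "T \<subseteq> {..<i}" "card T = k"
  let ?S = "(!) vs ` T"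
  have "inj_on ((!) vs) T"
    using T(1) assms by (intro inj_on_nth) (auto simp: length_sorted_list)
  moreover have "?S \<subseteq> V"
  proof
    fix v assume "v \<in> ?S"
    then obtain j where "j \<in> T" "v = vs ! j" by blast
    with T(1) assms finite_V show "v \<in> V"
      by (metis length_sorted_list lessThan_iff nth_mem order_less_le_trans set_sorted_list_of_set subsetD)
  qed
  ultimately have S: "?S \<in> scopes k V"
    using T by (simp add: scopes_def card_image)
  then obtain \<alpha> where \<alpha>: "\<alpha> \<in> ?S \<rightarrow>\<^sub>E UNIV" "\<not> P ?S \<alpha>"
    using complete unfolding complete_csp_def by blast
  have "\<exists>j\<in>T. a ! j \<noteq> \<alpha> (vs ! j)" if a: "length a = i" "good a" for a
  proof (rule ccontr)
    assume agree: "\<not> ?thesis"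
    have "j < length a \<and> a ! j = \<alpha> (vs ! j)" if "j < card V" "vs ! j \<in> ?S" for j
    proof -
      from that(2) obtain l where l: "l \<in> T" "vs ! j = vs ! l" by blast
      have "l < card V" using l(1) T(1) assms by auto
      then have "j = l"
        using l(2) that(1) nth_eq_iff_index_eq[of vs j l] by (simp add: length_sorted_list)
      with l agree T(1) a(1) show ?thesis by auto
    qed
    then have "violated k a (map (\<lambda>v. v \<in> ?S) vs, truth_table P (filter (\<lambda>v. v \<in> ?S) vs)) \<longleftrightarrow>
        \<not> P ?S (restrict \<alpha> ?S)"
      by (rule violated_scope[OF S])
    \<comment> \<open>The rejected pattern is extensional on its scope, so restricting it changes
      nothing.\<close>
    moreover have "restrict \<alpha> ?S = \<alpha>" using \<alpha>(1) by (rule PiE_restrict)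
    ultimately show False using \<alpha>(2) a(2) S unfolding good_iff by auto
  qed
  then show "\<exists>p. \<forall>a\<in>{a. length a = i \<and> good a}. \<exists>j\<in>T. a ! j \<noteq> p j"
    by (intro exI[of _ "\<lambda>j. \<alpha> (vs ! j)"]) auto
qed simp

lemma tree_size_root_le: "tree_size (card V) [] \<le> 1 + 2 * (card V * (card V + 1) ^ k)"
proof -
  have "{c. length c < card V \<and> good ([] @ c)} = (\<Union>i<card V. {c. length c = i \<and> good c})"
    by auto
  then have "card {c. length c < card V \<and> good ([] @ c)} \<le> (\<Sum>i<card V. card {c. length c = i \<and> good c})"
    by (simp only:) (rule card_UN_le, simp)
  also have "\<dots> \<le> (\<Sum>i<card V. (card V + 1) ^ k)"
  proof (rule sum_mono)
    fix i assume "i \<in> {..<card V}"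
    then have i: "i \<le> card V" by simp
    have "(i + 1) ^ k \<le> (card V + 1) ^ k" using i by (intro power_mono) auto
    with card_good_le[OF i] show "card {c. length c = i \<and> good c} \<le> (card V + 1) ^ k" by linarith
  qed
  finally show ?thesis using tree_size_le[of "card V" "[]"] by simp
qed

lemma length_blocks_le: "length (csp_blocks k V P) \<le> (card V + 1) ^ k"
  using length_subseqs_length_le[of k vs] by (simp add: csp_blocks_def Let_def length_sorted_list)

text \<open>\<open>B\<close> bounds both the number of constraints and the number of good
  assignments on a level. The term \<open>7 * n + 12\<close> collects \<open>5 * n + 9\<close> from
  a node, \<open>2 * n + 2\<close> from the header counted twice, and 1 from the check.\<close>

lemma total_time_le:
  fixes B n
  defines "n \<equiv> card V" and "B \<equiv> (card V + 1) ^ k"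
  shows "total_time \<le> 2 * n + 3 +
    (B * (2 * n + 2 + 2 ^ k) + 2 * (B * (n + 2 ^ k)) + 7 * n + 12) * (1 + 2 * (n * B))"
proof -
  have "node_time = length (csp_blocks k V P) * (2 * n + 2 + 2 ^ k) +
      2 * (length (csp_blocks k V P) * (n + 2 ^ k)) + 7 * n + 12"
    unfolding node_time_def check_time_def length_word n_def by simp
  also have "\<dots> \<le> B * (2 * n + 2 + 2 ^ k) + 2 * (B * (n + 2 ^ k)) + 7 * n + 12"
    using length_blocks_le unfolding B_def by (intro add_mono mult_mono) auto
  finally show ?thesis
    using tree_size_root_le unfolding total_time_def B_def n_def by (intro add_mono mult_mono) auto
qed

end

theorem theorem1p2:
  fixes k :: nat
  assumes "k \<ge> 2"
  shows "\<exists>(M :: turing_machine) (p :: nat poly). wf_tm M \<and>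
           (\<forall>(V :: nat set) (P :: constraints). complete_csp k V P \<longrightarrow>
              halts_within M (encode_csp k V P) (poly p (card V)) \<and>
              (tm_accepts M (encode_csp k V P) \<longleftrightarrow> csp_satisfiable k V P))"
proof -
  \<comment> \<open>The bound of \<open>total_time_le\<close> is read as a polynomial, with the
    indeterminate \<open>[:0, 1:]\<close> in place of \<open>card V\<close>; evaluation commutes
    with the operations.\<close>
  define n B p :: "nat poly" where "n = [:0, 1:]" and "B = (n + 1) ^ k" and
    "p = 2 * n + 3 + (B * (2 * n + 2 + 2 ^ k) + 2 * (B * (n + 2 ^ k)) + 7 * n + 12) * (1 + 2 * (n * B))"
  have "halts_within (search_tm k) (encode_csp k V P) (poly p (card V)) \<and>
      (tm_accepts (search_tm k) (encode_csp k V P) \<longleftrightarrow> csp_satisfiable k V P)"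
    if "complete_csp k V P" for V P
  proof -
    interpret csp k V P by unfold_locales (rule that)
    have "poly n (card V) = card V" by (simp add: n_def)
    then have "total_time \<le> poly p (card V)"
      using total_time_le
      unfolding p_def B_def by (simp only: poly_add poly_mult poly_power poly_numeral poly_1)
    then show ?thesis
      using machine_correct satisfiable_iff unfolding word_csp_blocks halts_within_def
      by (meson order_trans)
  qed
  with wf_search_tm show ?thesis by blast
qed

end
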